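(* Let a group $\mathcal{G}$ act on a space $\mathcal{X}$ from the left, and let $\mathcal{H}$ be a subgroup of $\mathcal{G}$. Suppose that there exists a global cross section $\mathcal{Z}$ for the action of $\mathcal{G}$ on $\mathcal{X}$, with the common isotropy subgroup $\mathcal{G}_0$ (that is, $\mathcal{G}_z=\mathcal{G}_0$ for all $z\in\mathcal{Z}$). Suppose furthermore that there exists a complete set $\mathcal{G}'=\{g_i: i\in I\}\subset\mathcal{G}$ of representatives of the double cosets $\mathcal{H}g\mathcal{G}_0$, $g\in\mathcal{G}$, in $\mathcal{G}$ such that the isotropy subgroup $\mathcal{H}_{g_i\mathcal{G}_0}=\{h\in\mathcal{H}: hg_i\mathcal{G}_0=g_i\mathcal{G}_0\}$ does not depend on $i\in I$. Then $$\mathcal{V}=\{g_i\mathcal{G}_0: i\in I\}$$ is a global cross section for the action of $\mathcal{H}$ on $\mathcal{G}/\mathcal{G}_0$.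
   Context: For a group $G$ acting from the left on a set $X$: the isotropy subgroup at $x$ is $G_x=\{g\in G: gx=x\}$; a cross section is a subset of $X$ that intersects each orbit $Gx$, $x\in X$, exactly once; a global cross section is a cross section all of whose points have the same isotropy subgroup. $\mathcal{G}/\mathcal{G}_0=\{g\mathcal{G}_0: g\in\mathcal{G}\}$ is the left coset space, and $\mathcal{H}$ acts on it by $(h,g\mathcal{G}_0)\mapsto (hg)\mathcal{G}_0$. The double cosets are $\mathcal{H}g\mathcal{G}_0=\{hgg_0: h\in\mathcal{H},\ g_0\in\mathcal{G}_0\}$; $\{g_i: i\in I\}$ is a complete set of representatives if $\mathcal{G}=\bigsqcup_{i\in I}\mathcal{H}g_i\mathcal{G}_0$ (disjoint union). *)

theory Defs
  imports
    "HOL-Algebra.Group_Action"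
    "HOL-Algebra.Left_Coset"
    "HOL-Library.Disjoint_Sets"
begin

definition cross_section ::
    "('a, 'm) monoid_scheme \<Rightarrow> 'b set \<Rightarrow> ('a \<Rightarrow> 'b \<Rightarrow> 'b) \<Rightarrow> 'b set \<Rightarrow> bool" where
  "cross_section G E \<phi> Z \<longleftrightarrow> Z \<subseteq> E \<and> (\<forall>x\<in>E. \<exists>!z. z \<in> Z \<inter> orbit G \<phi> x)"

definition global_cross_section ::
    "('a, 'm) monoid_scheme \<Rightarrow> 'b set \<Rightarrow> ('a \<Rightarrow> 'b \<Rightarrow> 'b) \<Rightarrow> 'b set \<Rightarrow> bool" where
  "global_cross_section G E \<phi> Z \<longleftrightarrow>
     cross_section G E \<phi> Z \<and> (\<forall>z\<in>Z. \<forall>w\<in>Z. stabilizer G \<phi> z = stabilizer G \<phi> w)"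

text \<open>Left translation of the left cosets of \<open>K\<close>. It is restricted to \<open>lcosets\<^bsub>G\<^esub> K\<close> because
  \<open>group_action\<close> takes values in \<open>BijGroup\<close>, whose elements are extensional functions.\<close>

definition lcoset_action ::
    "('a, 'm) monoid_scheme \<Rightarrow> 'a set \<Rightarrow> 'a \<Rightarrow> 'a set \<Rightarrow> 'a set" where
  "lcoset_action G K h = (\<lambda>C \<in> lcosets\<^bsub>G\<^esub> K. h <#\<^bsub>G\<^esub> C)"

definition double_coset ::
    "('a, 'm) monoid_scheme \<Rightarrow> 'a set \<Rightarrow> 'a \<Rightarrow> 'a set \<Rightarrow> 'a set" where
  "double_coset G H g K = {h \<otimes>\<^bsub>G\<^esub> g \<otimes>\<^bsub>G\<^esub> k | h k. h \<in> H \<and> k \<in> K}"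

definition double_coset_representatives ::
    "('a, 'm) monoid_scheme \<Rightarrow> 'a set \<Rightarrow> 'a set \<Rightarrow> 'i set \<Rightarrow> ('i \<Rightarrow> 'a) \<Rightarrow> bool" where
  "double_coset_representatives G H K I g \<longleftrightarrow>
     g \<in> I \<rightarrow> carrier G \<and>
     carrier G = (\<Union>i\<in>I. double_coset G H (g i) K) \<and>
     disjoint_family_on (\<lambda>i. double_coset G H (g i) K) I"

lemma (in group) lcoset_action_l_coset:
  assumes "subgroup K G" "h \<in> carrier G" "g \<in> carrier G"
  shows "lcoset_action G K h (g <# K) = (h \<otimes> g) <# K"
  using assms by (auto simp: lcoset_action_def LCOSETS_def lcos_m_assoc subgroup.subset)

lemma (in group) group_action_lcoset_action:
  assumes H: "subgroup H G" and K: "subgroup K G"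
  shows "group_action (G\<lparr>carrier := H\<rparr>) (lcosets K) (lcoset_action G K)"
proof -
  let ?E = "lcosets K" and ?\<phi> = "lcoset_action G K"
  have E: "C \<in> ?E \<longleftrightarrow> (\<exists>g\<in>carrier G. C = g <# K)" for C
    by (auto simp: LCOSETS_def)
  have inH: "h \<in> carrier G" if "h \<in> H" for h
    using H that by (rule subgroup.mem_carrier)
  have closed: "?\<phi> h C \<in> ?E" if "h \<in> carrier G" "C \<in> ?E" for h C
    using that K by (auto simp: E lcoset_action_l_coset)
  have comp: "?\<phi> (h \<otimes> h') C = ?\<phi> h (?\<phi> h' C)"
    if "h \<in> carrier G" "h' \<in> carrier G" "C \<in> ?E" for h h' C
    using that K by (auto simp: E lcoset_action_l_coset m_assoc)
  have one: "?\<phi> \<one> C = C" if "C \<in> ?E" for C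
    using that K by (auto simp: E lcoset_action_l_coset)
  have ext: "?\<phi> h \<in> extensional ?E" for h
    by (simp add: lcoset_action_def)
  have bij: "?\<phi> h \<in> Bij ?E" if h: "h \<in> carrier G" for h
  proof -
    have "bij_betw (?\<phi> h) ?E ?E"
      by (rule bij_betw_byWitness[where f' = "?\<phi> (inv h)"])
        (use h closed one in \<open>auto simp flip: comp\<close>)
    with ext show ?thesis by (simp add: Bij_def)
  qed
  have "?\<phi> \<in> hom (G\<lparr>carrier := H\<rparr>) (BijGroup ?E)"
  proof (rule homI)
    show "?\<phi> x \<in> carrier (BijGroup ?E)" if "x \<in> carrier (G\<lparr>carrier := H\<rparr>)" for x
      using that bij inH by (simp add: BijGroup_def)
    show "?\<phi> (x \<otimes>\<^bsub>G\<lparr>carrier := H\<rparr>\<^esub> y) = ?\<phi> x \<otimes>\<^bsub>BijGroup ?E\<^esub> ?\<phi> y"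
      if "x \<in> carrier (G\<lparr>carrier := H\<rparr>)" "y \<in> carrier (G\<lparr>carrier := H\<rparr>)" for x y
    proof -
      have "?\<phi> (x \<otimes> y) = compose ?E (?\<phi> x) (?\<phi> y)"
        using that inH by (intro extensionalityI[OF ext]) (auto simp: comp compose_def)
      with that bij inH show ?thesis by (simp add: BijGroup_def)
    qed
  qed
  then show ?thesis
    using subgroup.subgroup_is_group[OF H is_group] group_BijGroup
    by (simp add: group_action_def group_hom_def group_hom_axioms_def)
qed

end

theory Submission
  imports Defs
begin

text \<open>The orbits of \<open>H\<close> on the left cosets of \<open>K\<close> are the double
  cosets in disguise: the union of the cosets in the orbit of \<open>a <# K\<close> is the double
  coset of \<open>a\<close>. Hence \<open>r <# K\<close> lies in the orbit of \<open>a <# K\<close>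
  exactly when \<open>a\<close> lies in \<open>double_coset G H r K\<close>, which is what
  \<open>lcoset_in_orbit_iff_double_coset\<close> says. Through this dictionary, a decomposition of
  the group into disjoint double cosets of the \<open>g i\<close> becomes the statement that every
  orbit contains exactly one coset \<open>g i <# K\<close>: covering gives existence and
  disjointness gives uniqueness. So these cosets form a cross section, and the assumed independence
  of their isotropy subgroups from the index makes it global.\<close>

lemma (in group) lcoset_in_orbit_iff_double_coset:
  assumes H: "subgroup H G" and K: "subgroup K G"
    and r: "r \<in> carrier G" and a: "a \<in> carrier G"
  shows "r <# K \<in> orbit (G\<lparr>carrier := H\<rparr>) (lcoset_action G K) (a <# K) \<longleftrightarrow>
    a \<in> double_coset G H r K"
proof -
  have inH: "h \<in> carrier G" if "h \<in> H" for h
    using H that by (rule subgroup.mem_carrier)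
  have inK: "k \<in> carrier G" if "k \<in> K" for k
    using K that by (rule subgroup.mem_carrier)
  have "orbit (G\<lparr>carrier := H\<rparr>) (lcoset_action G K) (a <# K) =
      (\<lambda>h. lcoset_action G K h (a <# K)) ` H"
    by (auto simp: orbit_def)
  also have "\<dots> = (\<lambda>h. (h \<otimes> a) <# K) ` H"
    using lcoset_action_l_coset[OF K inH a] by (intro image_cong refl)
  finally have "r <# K \<in> orbit (G\<lparr>carrier := H\<rparr>) (lcoset_action G K) (a <# K) \<longleftrightarrow>
      (\<exists>h\<in>H. r <# K = (h \<otimes> a) <# K)"
    by (simp add: image_iff)
  \<comment> \<open>Left cosets partition the group, so \<open>r <# K\<close> equals the coset of
    \<open>h \<otimes> a\<close> as soon as it contains that element.\<close>
  also have "\<dots> \<longleftrightarrow> (\<exists>h\<in>H. h \<otimes> a \<in> r <# K)"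
  proof (intro bex_cong refl iffI)
    fix h assume h: "h \<in> H"
    show "h \<otimes> a \<in> r <# K" if "r <# K = (h \<otimes> a) <# K"
      using lcos_self[OF _ K, of "h \<otimes> a"] h a inH that by simp
    show "r <# K = (h \<otimes> a) <# K" if "h \<otimes> a \<in> r <# K"
      using that r K by (rule l_repr_independence)
  qed
  also have "\<dots> \<longleftrightarrow> (\<exists>h\<in>H. \<exists>k\<in>K. h \<otimes> a = r \<otimes> k)"
    by (auto simp: l_coset_def)
  \<comment> \<open>Moving \<open>h\<close> to the other side replaces it by its inverse, so in both
    directions the witnesses are \<open>inv h\<close> and the same \<open>k\<close>;
    \<open>H\<close> is closed under inverses.\<close>
  also have "\<dots> \<longleftrightarrow> (\<exists>h\<in>H. \<exists>k\<in>K. a = h \<otimes> r \<otimes> k)"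
  proof
    assume "\<exists>h\<in>H. \<exists>k\<in>K. h \<otimes> a = r \<otimes> k"
    then obtain h k where "h \<in> H" "k \<in> K" "h \<otimes> a = r \<otimes> k" by blast
    moreover from this have "a = inv h \<otimes> (r \<otimes> k)"
      using a r inH inK by (subst inv_solve_left) simp_all
    ultimately have "a = inv h \<otimes> r \<otimes> k"
      using r inH inK by (simp only: m_assoc inv_closed)
    then show "\<exists>h\<in>H. \<exists>k\<in>K. a = h \<otimes> r \<otimes> k"
      using \<open>h \<in> H\<close> \<open>k \<in> K\<close> subgroup.m_inv_closed[OF H] by blast
  next
    assume "\<exists>h\<in>H. \<exists>k\<in>K. a = h \<otimes> r \<otimes> k"
    then obtain h k where "h \<in> H" "k \<in> K" "a = h \<otimes> r \<otimes> k" by blast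
    moreover from this have "a = h \<otimes> (r \<otimes> k)"
      using r inH inK by (simp only: m_assoc)
    ultimately have "inv h \<otimes> a = r \<otimes> k"
      using a r inH inK by (subst inv_solve_left') simp_all
    then show "\<exists>h\<in>H. \<exists>k\<in>K. h \<otimes> a = r \<otimes> k"
      using \<open>h \<in> H\<close> \<open>k \<in> K\<close> subgroup.m_inv_closed[OF H] by blast
  qed
  finally show ?thesis by (auto simp: double_coset_def)
qed

theorem theorem3p2:
  fixes G :: "('a, 'm) monoid_scheme"
    and X :: "'b set"
    and \<phi> :: "'a \<Rightarrow> 'b \<Rightarrow> 'b"
    and H G\<^sub>0 :: "'a set"
    and Z :: "'b set"
    and I :: "'i set"
    and g :: "'i \<Rightarrow> 'a"
  assumes "group_action G X \<phi>"
    and "subgroup H G"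
    and "global_cross_section G X \<phi> Z"
    and "subgroup G\<^sub>0 G"
    and "\<forall>z\<in>Z. stabilizer G \<phi> z = G\<^sub>0"
    and "double_coset_representatives G H G\<^sub>0 I g"
    and "\<forall>i\<in>I. \<forall>j\<in>I.
           stabilizer (G\<lparr>carrier := H\<rparr>) (lcoset_action G G\<^sub>0) (g i <#\<^bsub>G\<^esub> G\<^sub>0) =
           stabilizer (G\<lparr>carrier := H\<rparr>) (lcoset_action G G\<^sub>0) (g j <#\<^bsub>G\<^esub> G\<^sub>0)"
  shows "global_cross_section (G\<lparr>carrier := H\<rparr>) (lcosets\<^bsub>G\<^esub> G\<^sub>0) (lcoset_action G G\<^sub>0)
           {g i <#\<^bsub>G\<^esub> G\<^sub>0 | i. i \<in> I}"
proof -
  interpret group G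
    using assms(1) by (simp add: group_action_def group_hom_def)
  note H = assms(2) and K = assms(4)
  let ?H = "G\<lparr>carrier := H\<rparr>" and ?act = "lcoset_action G G\<^sub>0"
  let ?V = "{g i <#\<^bsub>G\<^esub> G\<^sub>0 | i. i \<in> I}"
  from assms(6) have g: "\<And>i. i \<in> I \<Longrightarrow> g i \<in> carrier G"
    and cover: "carrier G = (\<Union>i\<in>I. double_coset G H (g i) G\<^sub>0)"
    and disj: "disjoint_family_on (\<lambda>i. double_coset G H (g i) G\<^sub>0) I"
    by (auto simp: double_coset_representatives_def)
  have "\<exists>!z. z \<in> ?V \<inter> orbit ?H ?act C" if C: "C \<in> lcosets\<^bsub>G\<^esub> G\<^sub>0" for C
  proof -
    from C obtain a where a: "a \<in> carrier G" "C = a <#\<^bsub>G\<^esub> G\<^sub>0"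
      by (auto simp: LCOSETS_def)
    \<comment> \<open>Whether the orbit of \<open>C\<close> meets \<open>?V\<close> at the coset of
      \<open>g i\<close> is now a question about the single element \<open>a\<close> and the double
      coset of \<open>g i\<close>.\<close>
    have orbit_iff: "g i <#\<^bsub>G\<^esub> G\<^sub>0 \<in> orbit ?H ?act C \<longleftrightarrow> a \<in> double_coset G H (g i) G\<^sub>0"
      if "i \<in> I" for i
      using lcoset_in_orbit_iff_double_coset[OF H K g[OF that] a(1)] a(2) by simp
    from a(1) cover obtain i where i: "i \<in> I" "a \<in> double_coset G H (g i) G\<^sub>0"
      by blast
    \<comment> \<open>Disjointness is indexed: distinct indices have disjoint double cosets. A
      common element \<open>a\<close> therefore identifies the indices themselves, and with them the
      cosets.\<close>
    have unique: "j = i" if "j \<in> I" "a \<in> double_coset G H (g j) G\<^sub>0" for j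
      using that i disj by (auto simp: disjoint_family_on_def)
    show ?thesis
    proof (rule ex1I)
      show "g i <#\<^bsub>G\<^esub> G\<^sub>0 \<in> ?V \<inter> orbit ?H ?act C"
        using i orbit_iff by blast
      show "z = g i <#\<^bsub>G\<^esub> G\<^sub>0" if "z \<in> ?V \<inter> orbit ?H ?act C" for z
        using that orbit_iff unique by blast
    qed
  qed
  moreover have "?V \<subseteq> lcosets\<^bsub>G\<^esub> G\<^sub>0"
    using g by (auto simp: LCOSETS_def)
  ultimately have "cross_section ?H (lcosets\<^bsub>G\<^esub> G\<^sub>0) ?act ?V"
    unfolding cross_section_def by (intro conjI ballI)
  \<comment> \<open>Points of \<open>?V\<close> are compared through chosen indices, to which the
    assumption on isotropy subgroups applies.\<close>
  moreover have "stabilizer ?H ?act z = stabilizer ?H ?act w" if "z \<in> ?V" "w \<in> ?V" for z w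
  proof -
    from that obtain i j where "i \<in> I" "z = g i <#\<^bsub>G\<^esub> G\<^sub>0" "j \<in> I" "w = g j <#\<^bsub>G\<^esub> G\<^sub>0"
      by blast
    then show ?thesis
      using assms(7)[rule_format, of i j] by simp
  qed
  ultimately show ?thesis
    unfolding global_cross_section_def by (intro conjI ballI)
qed

end
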